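(* Let $(\mathcal{Z},\mathfrak{Z})$ be a measurable space, $P$ a probability measure on it, $\alpha>0$, and let $\ell:\mathcal{Z}\to(-\infty,\infty]$ be measurable, $\ell\in\mathcal{L}^1(P)$, and bounded below $P$-almost surely. Let $f:[0,\infty)\to(-\infty,\infty]$ be proper, lower semicontinuous and convex, finite, differentiable and strictly convex on $(0,\infty)$, with $f(1)=0$, $f(t)\ge 0$ for all $t\ge 0$ with equality only at $t=1$, $f'_+(0):=\lim_{t\downarrow 0}f'(t)\in[-\infty,\infty)$, and $\lim_{t\uparrow\infty}f'(t)=\infty$. For $\lambda\in\mathbb{R}$ and $z\in\mathcal{Z}$ with $\ell(z)<\infty$ (hence for $P$-a.e. $z$) define $$u_\lambda(z)=\underset{t\ge 0}{\mathrm{arg\,min}}\{\alpha f(t)+(\ell(z)+\lambda)t\}.$$ Then $u_\lambda$ is (well defined and) measurable and is given by $$u_\lambda(z)=\begin{cases}0, & -\dfrac{\ell(z)+\lambda}{\alpha}\le f'_+(0),\\[0.6em] (f')^{-1}\!\left(-\dfrac{\ell(z)+\lambda}{\alpha}\right), & -\dfrac{\ell(z)+\lambda}{\alpha}>f'_+(0),\end{cases}$$ where the first branch is void when $f'_+(0)=-\infty$. There is a unique $\lambda^\star\in\mathbb{R}$ satisfying $\int_{\mathcal{Z}}u_{\lambda^\star}\,\mathrm{d}P=1$. The function $u^\star=u_{\lambda^\star}$ is the unique (up to $P$-a.e. equality) minimizer of $$\inf_{u\in\mathcal{U}}\int_{\mathcal{Z}}\{\ell u+\alpha f(u)\}\,\mathrm{d}P,\qquad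 \mathcal{U}=\left\{u:\mathcal{Z}\to[0,\infty)\ \text{measurable}:\int_{\mathcal{Z}}u\,\mathrm{d}P=1\right\}.$$ Equivalently, the unique solution of $$\underset{Q\in\mathcal{P}(\mathcal{Z})}{\mathrm{arg\,min}}\left\{\int_{\mathcal{Z}}\ell\,\mathrm{d}Q+\alpha\,\mathsf{D}_f(Q\Vert P)\right\}$$ is the probability measure $Q^\star$ with $\mathrm{d}Q^\star/\mathrm{d}P=u_{\lambda^\star}$.
   Context: $\mathcal{P}(\mathcal{Z})$ is the set of all probability measures on $(\mathcal{Z},\mathfrak{Z})$. The $f$-divergence is $\mathsf{D}_f(Q\Vert P)=\int_{\mathcal{Z}}f(\mathrm{d}Q/\mathrm{d}P)\,\mathrm{d}P$ if $Q\ll P$, and $\mathsf{D}_f(Q\Vert P)=\infty$ otherwise. Integrals are extended integrals in $(-\infty,\infty]$, defined whenever the negative part of the integrand has finite integral. The value of $u_\lambda$ on the $P$-null set $\{\ell=\infty\}$ is immaterial (e.g. set it to $0$). $(f')^{-1}$ denotes the inverse of the strictly increasing map $f':(0,\infty)\to(f'_+(0),\infty)$. *)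

theory Defs
  imports "HOL-Probability.Probability"
begin

text \<open>
  A function from \<open>[0, \<infinity>)\<close> to \<open>(-\<infinity>, \<infinity>]\<close> is represented by some
  \<open>f :: real \<Rightarrow> ereal\<close>; none of the notions below, used with \<open>S = {0..}\<close>, depends on the
  values of \<open>f\<close> at negative reals.
\<close>

definition proper_on :: "real set \<Rightarrow> (real \<Rightarrow> ereal) \<Rightarrow> bool" where
  "proper_on S f \<longleftrightarrow> (\<forall>t\<in>S. f t \<noteq> -\<infinity>) \<and> (\<exists>t\<in>S. f t \<noteq> \<infinity>)"

definition lsc_on :: "real set \<Rightarrow> (real \<Rightarrow> ereal) \<Rightarrow> bool" where
  "lsc_on S f \<longleftrightarrow> (\<forall>t\<in>S. f t \<le> Liminf (at t within S) f)"

text \<open>Convexity is meant for \<open>f > -\<infinity>\<close> on \<open>S\<close>; recall that \<open>0 * \<infinity> = 0\<close> in \<open>ereal\<close>.\<close>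

definition ereal_convex_on :: "real set \<Rightarrow> (real \<Rightarrow> ereal) \<Rightarrow> bool" where
  "ereal_convex_on S f \<longleftrightarrow> convex S \<and>
     (\<forall>x\<in>S. \<forall>y\<in>S. \<forall>a\<in>{0..1}.
        f ((1 - a) * x + a * y) \<le> ereal (1 - a) * f x + ereal a * f y)"

definition ereal_strictly_convex_on :: "real set \<Rightarrow> (real \<Rightarrow> ereal) \<Rightarrow> bool" where
  "ereal_strictly_convex_on S f \<longleftrightarrow> convex S \<and>
     (\<forall>x\<in>S. \<forall>y\<in>S. \<forall>a\<in>{0<..<1}. x \<noteq> y \<longrightarrow>
        f ((1 - a) * x + a * y) < ereal (1 - a) * f x + ereal a * f y)"

text \<open>The derivative is only used at points \<open>t > 0\<close>, near which \<open>f\<close> is finite.\<close>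

definition fprime :: "(real \<Rightarrow> ereal) \<Rightarrow> real \<Rightarrow> real" where
  "fprime f = deriv (\<lambda>t. real_of_ereal (f t))"

definition fprime_at_0 :: "(real \<Rightarrow> ereal) \<Rightarrow> ereal" where
  "fprime_at_0 f = Lim (at_right 0) (\<lambda>t. ereal (fprime f t))"

definition fprime_inv :: "(real \<Rightarrow> ereal) \<Rightarrow> real \<Rightarrow> real" where
  "fprime_inv f = the_inv_into {0<..} (fprime f)"

text \<open>
  Extended integral, as the difference of the integrals of the positive and the negative part
  (\<open>e2ennreal\<close> sends negative arguments to \<open>0\<close>).
\<close>

definition ext_integral :: "'a measure \<Rightarrow> ('a \<Rightarrow> ereal) \<Rightarrow> ereal" where
  "ext_integral M g =
     enn2ereal (\<integral>\<^sup>+ z. e2ennreal (g z) \<partial>M) - enn2ereal (\<integral>\<^sup>+ z. e2ennreal (- g z) \<partial>M)"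

definition ext_integral_defined :: "'a measure \<Rightarrow> ('a \<Rightarrow> ereal) \<Rightarrow> bool" where
  "ext_integral_defined M g \<longleftrightarrow>
     g \<in> borel_measurable M \<and> (\<integral>\<^sup>+ z. e2ennreal (- g z) \<partial>M) < \<infinity>"

definition f_divergence :: "(real \<Rightarrow> ereal) \<Rightarrow> 'a measure \<Rightarrow> 'a measure \<Rightarrow> ereal" where
  "f_divergence f Q P =
     (if absolutely_continuous P Q
      then ext_integral P (\<lambda>z. f (enn2real (RN_deriv P Q z)))
      else \<infinity>)"

definition u_obj :: "(real \<Rightarrow> ereal) \<Rightarrow> real \<Rightarrow> ('a \<Rightarrow> ereal) \<Rightarrow> real \<Rightarrow> 'a \<Rightarrow> real \<Rightarrow> ereal" where
  "u_obj f \<alpha> l lam z t = ereal \<alpha> * f t + (l z + ereal lam) * ereal t"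

definition u_fun :: "(real \<Rightarrow> ereal) \<Rightarrow> real \<Rightarrow> ('a \<Rightarrow> ereal) \<Rightarrow> real \<Rightarrow> 'a \<Rightarrow> real" where
  "u_fun f \<alpha> l lam z = (if l z = \<infinity> then 0 else arg_min_on (u_obj f \<alpha> l lam z) {0..})"

definition feasible_densities :: "'a measure \<Rightarrow> ('a \<Rightarrow> real) set" where
  "feasible_densities P =
     {u \<in> borel_measurable P. (\<forall>z\<in>space P. 0 \<le> u z) \<and> (\<integral>\<^sup>+ z. ennreal (u z) \<partial>P) = 1}"

definition density_integrand ::
    "(real \<Rightarrow> ereal) \<Rightarrow> real \<Rightarrow> ('a \<Rightarrow> ereal) \<Rightarrow> ('a \<Rightarrow> real) \<Rightarrow> 'a \<Rightarrow> ereal" where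
  "density_integrand f \<alpha> l u z = l z * ereal (u z) + ereal \<alpha> * f (u z)"

definition density_objective ::
    "(real \<Rightarrow> ereal) \<Rightarrow> real \<Rightarrow> 'a measure \<Rightarrow> ('a \<Rightarrow> ereal) \<Rightarrow> ('a \<Rightarrow> real) \<Rightarrow> ereal" where
  "density_objective f \<alpha> P l u = ext_integral P (density_integrand f \<alpha> l u)"

text \<open>
  If \<open>Q\<close> is not absolutely continuous with respect to \<open>P\<close>, the integral of \<open>l\<close> may fail to be
  defined; the objective is then \<open>\<infinity>\<close> all the same (for \<open>\<alpha> > 0\<close>), since \<open>x + \<infinity> = \<infinity>\<close> for
  every \<open>x :: ereal\<close>, including \<open>x = -\<infinity>\<close>.
\<close>

definition measure_objective ::
    "(real \<Rightarrow> ereal) \<Rightarrow> real \<Rightarrow> 'a measure \<Rightarrow> ('a \<Rightarrow> ereal) \<Rightarrow> 'a measure \<Rightarrow> ereal" where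
  "measure_objective f \<alpha> P l Q = ext_integral Q l + ereal \<alpha> * f_divergence f Q P"

end

theory Submission
  imports Defs
begin

text \<open>
  Where \<open>l z\<close> is finite, minimizing \<open>\<alpha> f(t) + (l z + \<lambda>) t\<close> means maximizing \<open>s t - f(t)\<close> with
  \<open>s = - (l z + \<lambda>) / \<alpha>\<close>; the unique maximizer \<open>conj_deriv s\<close> is determined by the Galois
  connection \<open>conj_deriv s < t \<longleftrightarrow> s < f'(t)\<close> for \<open>t > 0\<close>, which also makes it continuous.
  Hence \<open>\<lambda> \<mapsto> \<integral> u\<^sub>\<lambda> dP\<close> is continuous (dominated convergence, as \<open>l\<close> is bounded below), strictly
  decreasing where positive, and takes values on both sides of \<open>1\<close>. For the \<open>\<lambda>\<close> with integral
  \<open>1\<close>, the pointwise optimality of \<open>u\<^sub>\<lambda>\<close> is integrated: the term \<open>\<lambda> \<integral> (v - u\<^sub>\<lambda>) dP\<close> vanishes for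
  every competing density \<open>v\<close>, and pointwise strictness gives uniqueness.
\<close>

subsection \<open>Extended integrals\<close>

text \<open>The additivity of \<open>g + h\<close> written without subtraction: each positive part
  is moved to the side where it can be added. In this form it holds for infinite values too and can
  be integrated in \<open>ennreal\<close> term by term.\<close>

lemma e2ennreal_add_eq:
  assumes "0 \<le> h"
  shows "e2ennreal g + e2ennreal h + e2ennreal (- (g + h)) = e2ennreal (- g) + e2ennreal (g + h)"
proof (cases "\<bar>g\<bar> = \<infinity> \<or> h = \<infinity>")
  case True
  then show ?thesis
    by (cases g; cases h) (auto simp: e2ennreal_neg)
next
  case False
  then obtain r q where [simp]: "g = ereal r" "h = ereal q" and "0 \<le> q"
    using assms by (cases g; cases h) auto
  have "ennreal r + ennreal q + ennreal (- (r + q)) = ennreal (- r) + ennreal (r + q)"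
  proof (cases "0 \<le> r")
    case True
    then show ?thesis using \<open>0 \<le> q\<close> by (simp add: ennreal_neg)
  next
    case False
    then show ?thesis
      using \<open>0 \<le> q\<close> ennreal_plus[of "- r" "r + q"] ennreal_plus[of q "- (r + q)"]
      by (cases "0 \<le> r + q") (simp_all add: ennreal_neg)
  qed
  then show ?thesis by simp
qed

lemma ext_integral_cong_AE:
  "AE z in M. g z = h z \<Longrightarrow> ext_integral M g = ext_integral M h"
  unfolding ext_integral_def by (intro arg_cong2[of _ _ _ _ "(-)"] arg_cong[of _ _ enn2ereal] nn_integral_cong_AE) auto

lemma ext_integral_nonneg_eq:
  assumes "\<And>z. z \<in> space M \<Longrightarrow> 0 \<le> g z"
  shows "ext_integral M g = enn2ereal (\<integral>\<^sup>+ z. e2ennreal (g z) \<partial>M)"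
proof -
  have "(\<integral>\<^sup>+ z. e2ennreal (- g z) \<partial>M) = (\<integral>\<^sup>+ z. 0 \<partial>M)"
    using assms by (intro nn_integral_cong e2ennreal_neg) auto
  then show ?thesis by (simp add: ext_integral_def zero_ennreal.rep_eq)
qed

lemma ext_integral_defined_nonneg:
  assumes "g \<in> borel_measurable M" "\<And>z. z \<in> space M \<Longrightarrow> 0 \<le> g z"
  shows "ext_integral_defined M g"
proof -
  have "(\<integral>\<^sup>+ z. e2ennreal (- g z) \<partial>M) = (\<integral>\<^sup>+ z. 0 \<partial>M)"
    using assms(2) by (intro nn_integral_cong e2ennreal_neg) auto
  then show ?thesis using assms by (simp add: ext_integral_defined_def)
qed

lemma e2ennreal_times_ereal:
  assumes "0 \<le> c"
  shows "e2ennreal (g * ereal c) = ennreal c * e2ennreal g"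
  using assms
  by (cases g) (auto simp: ennreal_mult'' mult.commute[of "ennreal c"] ennreal_top_mult ennreal_mult_top e2ennreal_neg)

lemma ext_integral_cmult_nonneg:
  assumes "g \<in> borel_measurable M" "\<And>z. z \<in> space M \<Longrightarrow> 0 \<le> g z" "0 \<le> c"
  shows "ext_integral M (\<lambda>z. ereal c * g z) = ereal c * ext_integral M g"
proof -
  have "ext_integral M (\<lambda>z. ereal c * g z) = enn2ereal (\<integral>\<^sup>+ z. e2ennreal (ereal c * g z) \<partial>M)"
    using assms by (intro ext_integral_nonneg_eq) auto
  also have "(\<integral>\<^sup>+ z. e2ennreal (ereal c * g z) \<partial>M) = (\<integral>\<^sup>+ z. ennreal c * e2ennreal (g z) \<partial>M)"
    by (simp only: mult.commute[of "ereal c"] e2ennreal_times_ereal[OF assms(3)])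
  also have "\<dots> = ennreal c * (\<integral>\<^sup>+ z. e2ennreal (g z) \<partial>M)"
    using assms(1) by (intro nn_integral_cmult) measurable
  also have "enn2ereal \<dots> = ereal c * ext_integral M g"
    using assms by (simp add: ext_integral_nonneg_eq times_ennreal.rep_eq)
  finally show ?thesis .
qed

text \<open>Adding \<open>h \<ge> 0\<close> can only shrink the negative part, so the sum inherits
  definedness from \<open>g\<close>. The integral of \<open>h\<close> may be infinite.\<close>

lemma ext_integral_add_nonneg:
  assumes g: "ext_integral_defined M g"
    and h: "h \<in> borel_measurable M" "\<And>z. z \<in> space M \<Longrightarrow> 0 \<le> h z"
  shows "ext_integral_defined M (\<lambda>z. g z + h z)"
    and "ext_integral M (\<lambda>z. g z + h z) = ext_integral M g + ext_integral M h"
proof -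
  note [measurable] = h(1)
  have [measurable]: "g \<in> borel_measurable M"
    and fin: "(\<integral>\<^sup>+ z. e2ennreal (- g z) \<partial>M) < \<infinity>"
    using g by (auto simp: ext_integral_defined_def)
  have "(\<integral>\<^sup>+ z. e2ennreal (- (g z + h z)) \<partial>M) \<le> (\<integral>\<^sup>+ z. e2ennreal (- g z) \<partial>M)"
    using h(2) by (intro nn_integral_mono e2ennreal_mono) (auto simp: ereal_minus_le_minus add_increasing2)
  also note fin
  finally have fin': "(\<integral>\<^sup>+ z. e2ennreal (- (g z + h z)) \<partial>M) < \<infinity>" .
  then show "ext_integral_defined M (\<lambda>z. g z + h z)"
    by (simp add: ext_integral_defined_def)
  have "(\<integral>\<^sup>+ z. e2ennreal (g z) + e2ennreal (h z) + e2ennreal (- (g z + h z)) \<partial>M) =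
      (\<integral>\<^sup>+ z. e2ennreal (- g z) + e2ennreal (g z + h z) \<partial>M)"
    by (intro nn_integral_cong e2ennreal_add_eq h(2))
  then have *: "(\<integral>\<^sup>+ z. e2ennreal (g z) \<partial>M) + (\<integral>\<^sup>+ z. e2ennreal (h z) \<partial>M) +
        (\<integral>\<^sup>+ z. e2ennreal (- (g z + h z)) \<partial>M) =
      (\<integral>\<^sup>+ z. e2ennreal (- g z) \<partial>M) + (\<integral>\<^sup>+ z. e2ennreal (g z + h z) \<partial>M)"
    by (simp add: nn_integral_add)
  \<comment> \<open>The subtractions are restored: \<open>c\<close> and \<open>e\<close> stand for
    the integrals of the two negative parts, which are finite, while \<open>a\<close>,
    \<open>b\<close> and \<open>d\<close> may be infinite.\<close>
  have "enn2ereal d - enn2ereal c = (enn2ereal a - enn2ereal e) + enn2ereal b"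
    if "a + b + c = e + d" "c < \<infinity>" "e < \<infinity>" for a b c d e :: ennreal
    using that
    by (cases a; cases b; cases c; cases d; cases e)
       (auto simp: ennreal_plus[symmetric] top_unique enn2ereal_ennreal algebra_simps
        simp del: ennreal_plus)
  from this[OF * fin' fin]
  show "ext_integral M (\<lambda>z. g z + h z) = ext_integral M g + ext_integral M h"
    using ext_integral_nonneg_eq[of M h] h(2) by (simp add: ext_integral_def)
qed

lemma ext_integral_ereal:
  assumes "integrable M g"
  shows "ext_integral M (\<lambda>z. ereal (g z)) = ereal (\<integral>z. g z \<partial>M)"
proof -
  have "(\<integral>\<^sup>+ z. ennreal (g z) \<partial>M) \<noteq> \<infinity>" "(\<integral>\<^sup>+ z. ennreal (- g z) \<partial>M) \<noteq> \<infinity>"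
    using assms by (auto simp: real_integrable_def)
  then have *: "enn2ereal (\<integral>\<^sup>+ z. ennreal (g z) \<partial>M) = ereal (enn2real (\<integral>\<^sup>+ z. ennreal (g z) \<partial>M))"
    "enn2ereal (\<integral>\<^sup>+ z. ennreal (- g z) \<partial>M) = ereal (enn2real (\<integral>\<^sup>+ z. ennreal (- g z) \<partial>M))"
    by (metis enn2ereal_ennreal enn2real_nonneg ennreal_enn2real infinity_ennreal_def less_top)+
  show ?thesis
    by (simp add: ext_integral_def real_lebesgue_integral_def[OF assms] *)
qed

text \<open>With a finite negative part, an infinite positive part would make the extended integral
  \<open>\<infinity>\<close>; hence both parts are finite. This is the passage to Bochner
  integrals.\<close>

lemma ext_integral_defined_finiteD:
  assumes "ext_integral_defined M g" "ext_integral M g \<noteq> \<infinity>"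
  shows "AE z in M. g z = ereal (real_of_ereal (g z))"
    and "integrable M (\<lambda>z. real_of_ereal (g z))"
proof -
  have [measurable]: "g \<in> borel_measurable M"
    and neg: "(\<integral>\<^sup>+ z. e2ennreal (- g z) \<partial>M) \<noteq> \<infinity>"
    using assms by (auto simp: ext_integral_defined_def)
  have pos: "(\<integral>\<^sup>+ z. e2ennreal (g z) \<partial>M) \<noteq> \<infinity>"
  proof
    assume "(\<integral>\<^sup>+ z. e2ennreal (g z) \<partial>M) = \<infinity>"
    then have "ext_integral M g = \<infinity>"
      using neg by (cases "\<integral>\<^sup>+ z. e2ennreal (- g z) \<partial>M") (auto simp: ext_integral_def enn2ereal_ennreal)
    with assms(2) show False by simp
  qed
  have "AE z in M. e2ennreal (g z) \<noteq> \<infinity>" "AE z in M. e2ennreal (- g z) \<noteq> \<infinity>"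
    using pos neg by (intro nn_integral_PInf_AE; simp)+
  then show *: "AE z in M. g z = ereal (real_of_ereal (g z))"
  proof eventually_elim
    case (elim z)
    then show ?case by (cases "g z") auto
  qed
  have "(\<integral>\<^sup>+ z. ennreal (real_of_ereal (g z)) \<partial>M) = (\<integral>\<^sup>+ z. e2ennreal (g z) \<partial>M)"
    using * by (intro nn_integral_cong_AE) (auto elim!: eventually_mono simp flip: e2ennreal_ereal)
  moreover have "(\<integral>\<^sup>+ z. ennreal (- real_of_ereal (g z)) \<partial>M) = (\<integral>\<^sup>+ z. e2ennreal (- g z) \<partial>M)"
    using *
  proof (intro nn_integral_cong_AE, eventually_elim)
    case (elim z)
    then show ?case by (cases "g z") auto
  qed
  ultimately show "integrable M (\<lambda>z. real_of_ereal (g z))"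
    using pos neg by (simp add: real_integrable_def)
qed

text \<open>A factor \<open>u \<ge> 0\<close> commutes with taking positive and negative parts, so
  both parts transform by the usual density formula.\<close>

lemma
  assumes [measurable]: "u \<in> borel_measurable M" "g \<in> borel_measurable M"
    and u: "\<And>z. z \<in> space M \<Longrightarrow> 0 \<le> u z"
  shows ext_integral_density:
    "ext_integral (density M (\<lambda>z. ennreal (u z))) g = ext_integral M (\<lambda>z. g z * ereal (u z))"
    and ext_integral_defined_density_iff:
    "ext_integral_defined (density M (\<lambda>z. ennreal (u z))) g \<longleftrightarrow>
      ext_integral_defined M (\<lambda>z. g z * ereal (u z))"
proof -
  have *: "(\<integral>\<^sup>+ z. e2ennreal (h z) \<partial>density M (\<lambda>z. ennreal (u z))) =
      (\<integral>\<^sup>+ z. e2ennreal (h z * ereal (u z)) \<partial>M)" if [measurable]: "h \<in> borel_measurable M" for h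
    by (subst nn_integral_density)
       (auto intro!: nn_integral_cong simp: e2ennreal_times_ereal u)
  have "(\<lambda>z. - g z) \<in> borel_measurable M" by measurable
  note ** = *[OF assms(2)] *[OF this, unfolded ereal_mult_minus_left]
  show "ext_integral (density M (\<lambda>z. ennreal (u z))) g = ext_integral M (\<lambda>z. g z * ereal (u z))"
    and "ext_integral_defined (density M (\<lambda>z. ennreal (u z))) g \<longleftrightarrow>
      ext_integral_defined M (\<lambda>z. g z * ereal (u z))"
    by (simp_all add: ext_integral_def ext_integral_defined_def **)
qed

subsection \<open>The derivative of the conjugate function\<close>

locale divergence_generator =
  fixes f :: "real \<Rightarrow> ereal"
  assumes lsc: "lsc_on {0..} f"
    and convex: "ereal_convex_on {0..} f"
    and finite_pos: "t > 0 \<Longrightarrow> \<bar>f t\<bar> \<noteq> \<infinity>"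
    and differentiable_pos: "t > 0 \<Longrightarrow> (\<lambda>s. real_of_ereal (f s)) differentiable (at t)"
    and strictly_convex: "ereal_strictly_convex_on {0<..} f"
    and f_1: "f 1 = 0"
    and f_nonneg: "t \<ge> 0 \<Longrightarrow> 0 \<le> f t"
    and slope_tendsto: "((\<lambda>t. ereal (fprime f t)) \<longlongrightarrow> fprime_at_0 f) (at_right 0)"
    and slope_unbounded: "filterlim (fprime f) at_top at_top"
begin

text \<open>Where \<open>f 0 = \<infinity>\<close>, the value \<open>F 0\<close> is the default
  \<open>0\<close>; it is only used once \<open>f 0\<close> is known to be finite.\<close>

definition F :: "real \<Rightarrow> real" where
  "F t = real_of_ereal (f t)"

lemma f_eq_F: "t > 0 \<Longrightarrow> f t = ereal (F t)"
  using finite_pos by (simp add: F_def ereal_real')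

lemma has_real_derivative_F:
  assumes "t > 0"
  shows "(F has_real_derivative fprime f t) (at t)"
  unfolding fprime_def F_def using differentiable_pos[OF assms]
  by (simp add: DERIV_deriv_iff_real_differentiable)

section \<open>Tangent inequalities, and \<open>fprime f\<close> as a bijection\<close>

lemma F_strict_convex:
  assumes "x > 0" "y > 0" "x \<noteq> y" "0 < a" "a < 1"
  shows "F ((1 - a) * x + a * y) < (1 - a) * F x + a * F y"
proof -
  have "(1 - a) * x + a * y > 0"
    using assms by (intro add_pos_pos) auto
  then have F: "f ((1 - a) * x + a * y) = ereal (F ((1 - a) * x + a * y))"
    "f x = ereal (F x)" "f y = ereal (F y)"
    using assms by (auto intro: f_eq_F)
  have "\<forall>x\<in>{0<..}. \<forall>y\<in>{0<..}. \<forall>a\<in>{0<..<1}. x \<noteq> y \<longrightarrow>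
      f ((1 - a) * x + a * y) < ereal (1 - a) * f x + ereal a * f y"
    using strictly_convex unfolding ereal_strictly_convex_on_def by blast
  with assms have "f ((1 - a) * x + a * y) < ereal (1 - a) * f x + ereal a * f y"
    by simp
  then show ?thesis
    unfolding F by simp
qed

lemma convex_on_F: "convex_on {0<..} F"
proof (rule convex_onI)
  fix a x y :: real
  assume "0 < a" "a < 1" "x \<in> {0<..}" "y \<in> {0<..}"
  then show "F ((1 - a) *\<^sub>R x + a *\<^sub>R y) \<le> (1 - a) * F x + a * F y"
    using F_strict_convex[of x y a] by (cases "x = y") (auto simp: algebra_simps)
qed simp

lemma F_above_tangent:
  assumes "x > 0" "y > 0"
  shows "F x + fprime f x * (y - x) \<le> F y"
proof -
  have "F y - F x \<ge> fprime f x * (y - x)"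
    using assms
    by (intro convex_on_imp_above_tangent[OF convex_on_F])
       (auto simp: interior_open intro: has_field_derivative_at_within has_real_derivative_F)
  then show ?thesis by simp
qed

text \<open>The weak tangent inequality is applied at the midpoint of \<open>x\<close> and
  \<open>y\<close>, where strict convexity puts \<open>F\<close> strictly below the chord.\<close>

lemma F_strictly_above_tangent:
  assumes "x > 0" "y > 0" "x \<noteq> y"
  shows "F x + fprime f x * (y - x) < F y"
proof -
  have "F x + fprime f x * ((x + y) / 2 - x) \<le> F ((x + y) / 2)"
    using assms by (intro F_above_tangent) auto
  moreover have "F ((x + y) / 2) < (F x + F y) / 2"
    using F_strict_convex[of x y "1/2"] assms by (simp add: field_simps)
  ultimately show ?thesis
    by (simp add: field_simps)
qed

text \<open>Adding the strict tangent inequalities at \<open>x\<close> and at \<open>y\<close>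
  cancels the values of \<open>F\<close>.\<close>

lemma strict_mono_fprime: "strict_mono_on {0<..} (fprime f)"
proof (rule strict_mono_onI)
  fix x y :: real
  assume *: "x \<in> {0<..}" "y \<in> {0<..}" "x < y"
  have "F x + fprime f x * (y - x) < F y" "F y + fprime f y * (x - y) < F x"
    using * by (auto intro: F_strictly_above_tangent)
  then have "0 < (fprime f y - fprime f x) * (y - x)"
    by (simp add: algebra_simps)
  then show "fprime f x < fprime f y"
    using * by (simp add: zero_less_mult_iff)
qed

lemma fprime_less_iff: "x > 0 \<Longrightarrow> y > 0 \<Longrightarrow> fprime f x < fprime f y \<longleftrightarrow> x < y"
  using strict_mono_on_less[OF strict_mono_fprime] by auto

text \<open>The limit alone yields only \<open>\<le>\<close>; strictness is gained by bounding it by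
  the slope at \<open>t/2\<close> first.\<close>

lemma slope_0_less_fprime:
  assumes "t > 0"
  shows "fprime_at_0 f < ereal (fprime f t)"
proof -
  have "eventually (\<lambda>x. x \<in> {0<..<t/2}) (at_right 0)"
    using assms by (intro eventually_at_right_real) auto
  then have "eventually (\<lambda>x. ereal (fprime f x) \<le> ereal (fprime f (t/2))) (at_right 0)"
    by eventually_elim (auto simp: fprime_less_iff less_imp_le)
  then have "fprime_at_0 f \<le> ereal (fprime f (t/2))"
    by (intro tendsto_upperbound[OF slope_tendsto]) auto
  also have "\<dots> < ereal (fprime f t)"
    using assms by (simp add: fprime_less_iff)
  finally show ?thesis .
qed

text \<open>Darboux's argument, which does not presuppose continuity of \<open>fprime f\<close>: the
  limits at \<open>0\<close> and at infinity give \<open>a < b\<close> with slopes on either side of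
  \<open>s\<close>, and a minimizer of \<open>F t - s * t\<close> on \<open>{a..b}\<close> is
  interior, so the derivative vanishes there.\<close>

lemma fprime_surj:
  assumes "fprime_at_0 f < ereal s"
  obtains t where "t > 0" "fprime f t = s"
proof -
  have "eventually (\<lambda>t. ereal (fprime f t) < ereal s) (at_right 0)"
    using order_tendstoD(2)[OF slope_tendsto assms] .
  then have "eventually (\<lambda>t. fprime f t < s \<and> 0 < t) (at_right 0)"
    using eventually_at_right_less[of "0::real"] by eventually_elim auto
  then obtain a where a: "fprime f a < s" "0 < a"
    using eventually_happens'[OF trivial_limit_at_right_real] by blast
  have "eventually (\<lambda>t. s < fprime f t \<and> a < t) at_top"
    using slope_unbounded eventually_gt_at_top[of a]
    by (auto simp: filterlim_at_top_dense eventually_conj_iff)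
  then obtain b where b: "s < fprime f b" "a < b"
    using eventually_happens'[OF trivial_limit_at_top_linorder] by blast
  define h where "h = (\<lambda>t. F t - s * t)"
  have h: "(h has_real_derivative fprime f t - s) (at t)" if "t > 0" for t
    unfolding h_def
    using DERIV_diff[OF has_real_derivative_F[OF that] DERIV_cmult_Id[of s]] by simp
  have "continuous_on {a..b} h"
    using a by (intro continuous_at_imp_continuous_on ballI DERIV_isCont[OF h]) auto
  then obtain c where c: "c \<in> {a..b}" "\<And>t. t \<in> {a..b} \<Longrightarrow> h c \<le> h t"
    using continuous_attains_inf[of "{a..b}" h] b by auto
  have "c \<noteq> a"
  proof
    assume "c = a"
    obtain e where e: "e > 0" "\<And>r. 0 < r \<Longrightarrow> r < e \<Longrightarrow> h (a + r) < h a"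
      using DERIV_neg_dec_right[OF h[OF a(2)]] a(1) by auto
    define r where "r = min (e/2) (b - a)"
    then have r: "0 < r" "r < e" "r \<le> b - a"
      using e(1) b by auto
    show False
      using c(2)[of "a + r"] e(2)[of r] r \<open>c = a\<close> by auto
  qed
  moreover have "c \<noteq> b"
  proof
    assume "c = b"
    obtain e where e: "e > 0" "\<And>r. 0 < r \<Longrightarrow> r < e \<Longrightarrow> h (b - r) < h b"
      using DERIV_pos_inc_left[OF h[of b]] a(2) b by auto
    define r where "r = min (e/2) (b - a)"
    then have r: "0 < r" "r < e" "r \<le> b - a"
      using e(1) b by auto
    show False
      using c(2)[of "b - r"] e(2)[of r] r \<open>c = b\<close> by auto
  qed
  ultimately have "a < c" "c < b" using c(1) by auto
  then have "fprime f c - s = 0"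
    using a
    by (intro DERIV_local_min[OF h[of c], of "min (c - a) (b - c)"]) (auto intro!: c(2))
  then show ?thesis
    using that[of c] a \<open>a < c\<close> by auto
qed

lemma bij_betw_fprime: "bij_betw (fprime f) {0<..} {s. fprime_at_0 f < ereal s}"
proof (rule bij_betw_imageI)
  show "inj_on (fprime f) {0<..}"
    by (rule strict_mono_on_imp_inj_on[OF strict_mono_fprime])
  show "fprime f ` {0<..} = {s. fprime_at_0 f < ereal s}"
  proof (intro set_eqI iffI)
    fix s assume "s \<in> {s. fprime_at_0 f < ereal s}"
    then obtain t where "t > 0" "fprime f t = s"
      using fprime_surj[of s] by blast
    then show "s \<in> fprime f ` {0<..}" by (intro image_eqI[of s _ t]) simp_all
  next
    fix s assume "s \<in> fprime f ` {0<..}"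
    then obtain t where "t > 0" "s = fprime f t" by blast
    then show "s \<in> {s. fprime_at_0 f < ereal s}"
      using slope_0_less_fprime[of t] by simp
  qed
qed

lemma fprime_inv:
  assumes "fprime_at_0 f < ereal s"
  shows "fprime_inv f s > 0" "fprime f (fprime_inv f s) = s"
proof -
  have "s \<in> fprime f ` {0<..}"
    unfolding bij_betw_imp_surj_on[OF bij_betw_fprime] using assms by simp
  note s = bij_betw_imp_inj_on[OF bij_betw_fprime] this
  show "fprime_inv f s > 0"
    using the_inv_into_into[OF s subset_refl] by (simp add: fprime_inv_def)
  show "fprime f (fprime_inv f s) = s"
    using f_the_inv_into_f[OF s] by (simp add: fprime_inv_def)
qed

text \<open>\<open>conj_deriv\<close> is the derivative of the convex conjugate \<open>s \<mapsto> sup\<^sub>t (s t - f(t))\<close>.\<close>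

definition conj_deriv :: "real \<Rightarrow> real" where
  "conj_deriv s = (if ereal s \<le> fprime_at_0 f then 0 else fprime_inv f s)"

section \<open>Galois connection, monotonicity and continuity of \<open>conj_deriv\<close>\<close>

lemma conj_deriv_nonneg: "0 \<le> conj_deriv s"
  using fprime_inv(1)[of s] by (auto simp: conj_deriv_def not_le less_imp_le)

lemma conj_deriv_pos_iff: "0 < conj_deriv s \<longleftrightarrow> fprime_at_0 f < ereal s"
  using fprime_inv(1)[of s] by (auto simp: conj_deriv_def)

lemma conj_deriv_eq_0_iff: "conj_deriv s = 0 \<longleftrightarrow> ereal s \<le> fprime_at_0 f"
  using fprime_inv(1)[of s] by (auto simp: conj_deriv_def not_le)

lemma fprime_conj_deriv: "0 < conj_deriv s \<Longrightarrow> fprime f (conj_deriv s) = s"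
  using fprime_inv(2)[of s] by (auto simp: conj_deriv_def split: if_splits)

text \<open>A positive \<open>conj_deriv s\<close> has slope \<open>s\<close>, so this is the
  monotonicity of \<open>fprime f\<close>. If it is \<open>0\<close>, both sides are true, because
  \<open>s\<close> is at most the slope at \<open>0\<close>.\<close>

lemma conj_deriv_less_iff:
  assumes "t > 0"
  shows "conj_deriv s < t \<longleftrightarrow> s < fprime f t"
proof (cases "0 < conj_deriv s")
  case True
  then show ?thesis
    using fprime_less_iff[OF True assms] fprime_conj_deriv[OF True] by simp
next
  case False
  then have "conj_deriv s = 0" using conj_deriv_nonneg[of s] by simp
  then have "ereal s < ereal (fprime f t)"
    using slope_0_less_fprime[OF assms] unfolding conj_deriv_eq_0_iff by (rule le_less_trans)
  with \<open>conj_deriv s = 0\<close> assms show ?thesis by simp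
qed

lemma less_conj_deriv_iff:
  assumes "t > 0"
  shows "t < conj_deriv s \<longleftrightarrow> fprime f t < s"
proof (cases "0 < conj_deriv s")
  case True
  then show ?thesis
    using fprime_less_iff[OF assms True] fprime_conj_deriv[OF True] by simp
next
  case False
  then have "conj_deriv s < t" using assms by simp
  then show ?thesis
    using conj_deriv_less_iff[OF assms, of s] by simp
qed

text \<open>The Galois connection at \<open>t = conj_deriv s\<close>, where the slope is
  \<open>s\<close>. Positivity excludes the ray on which \<open>conj_deriv\<close> is constantly
  \<open>0\<close>.\<close>

lemma conj_deriv_strict_mono:
  assumes "r < s" "0 < conj_deriv s"
  shows "conj_deriv r < conj_deriv s"
  using assms by (simp add: conj_deriv_less_iff fprime_conj_deriv)

lemma conj_deriv_mono: "r \<le> s \<Longrightarrow> conj_deriv r \<le> conj_deriv s"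
  using conj_deriv_nonneg[of s] less_conj_deriv_iff[of "conj_deriv s" r]
    conj_deriv_pos_iff[of r] conj_deriv_pos_iff[of s]
    fprime_conj_deriv[of s]
  by (smt (verit) ereal_less_eq(3) less_le_trans)

text \<open>Strict sub- and superlevel sets are open. For \<open>t > 0\<close> the Galois connection
  makes them open rays; the superlevel set at \<open>t = 0\<close> is the ray above
  \<open>fprime_at_0 f\<close>, taken in \<open>ereal\<close> since that slope may be
  \<open>-\<infinity>\<close>, and for \<open>t < 0\<close> it is the whole line.\<close>

lemma isCont_conj_deriv: "isCont conj_deriv s"
  unfolding isCont_def
proof (rule order_tendstoI)
  fix t assume t: "t < conj_deriv s"
  have "open {r. t < conj_deriv r}"
  proof (cases "t > 0" "t = 0" rule: case_split[case_product case_split])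
    case True_True then show ?thesis by simp
  next
    case True_False
    then show ?thesis
      using open_greaterThan[of "fprime f t"] by (simp add: less_conj_deriv_iff greaterThan_def)
  next
    case False_True
    then have "{r. t < conj_deriv r} = ereal -` {fprime_at_0 f<..}"
      by (auto simp: conj_deriv_pos_iff)
    then show ?thesis
      using open_ereal_vimage[OF open_greaterThan] by simp
  next
    case False_False
    then have "{r. t < conj_deriv r} = UNIV"
      using conj_deriv_nonneg by (auto intro: less_le_trans[of t 0])
    then show ?thesis by simp
  qed
  from eventually_nhds_in_open[OF this, of s] t
  show "eventually (\<lambda>r. t < conj_deriv r) (at s)"
    unfolding eventually_at_filter by (auto elim: eventually_mono)
next
  fix t assume t: "conj_deriv s < t"
  then have "t > 0" using conj_deriv_nonneg[of s] by linarith
  then have "open {r. conj_deriv r < t}"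
    using open_lessThan[of "fprime f t"] by (simp add: conj_deriv_less_iff lessThan_def)
  from eventually_nhds_in_open[OF this, of s] t
  show "eventually (\<lambda>r. conj_deriv r < t) (at s)"
    unfolding eventually_at_filter by (auto elim: eventually_mono)
qed

lemma borel_measurable_conj_deriv: "conj_deriv \<in> borel_measurable borel"
  by (intro borel_measurable_continuous_onI continuous_at_imp_continuous_on ballI isCont_conj_deriv)

section \<open>Supporting lines, including the boundary point 0\<close>

lemma f_0_le:
  assumes "ereal c \<le> fprime_at_0 f" "t > 0"
  shows "f 0 + ereal (c * t) \<le> f t"
proof -
  have "ereal (F t - c * t) = Liminf (at_right 0) (\<lambda>x. ereal (F t - c * (t - x)))"
  proof (rule lim_imp_Liminf[symmetric])
    have "((\<lambda>x. F t - c * (t - x)) \<longlongrightarrow> F t - c * (t - 0)) (at_right 0)"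
      by (intro tendsto_intros)
    then show "((\<lambda>x. ereal (F t - c * (t - x))) \<longlongrightarrow> ereal (F t - c * t)) (at_right 0)"
      by simp
  qed simp
  have ev: "eventually (\<lambda>x. x \<in> {0<..<t}) (at_right 0)"
    using assms by (intro eventually_at_right_real) auto
  \<comment> \<open>The tangent at a small \<open>x > 0\<close>, evaluated at \<open>t\<close>,
    bounds \<open>f x\<close> from above, its slope exceeding \<open>c\<close>. Letting
    \<open>x\<close> tend to \<open>0\<close>, lower semicontinuity carries the bound over to
    \<open>f 0\<close>.\<close>
  have "eventually (\<lambda>x. f x \<le> ereal (F t - c * (t - x))) (at_right 0)"
    using ev
  proof eventually_elim
    case (elim x)
    then have "ereal c < ereal (fprime f x)"
      using slope_0_less_fprime[of x] by (intro le_less_trans[OF assms(1)]) auto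
    then have "c * (t - x) \<le> fprime f x * (t - x)"
      using elim by (intro mult_right_mono) auto
    moreover have "F x + fprime f x * (t - x) \<le> F t"
      using elim by (intro F_above_tangent) auto
    ultimately have "F x \<le> F t - c * (t - x)" by linarith
    then show ?case using elim by (simp add: f_eq_F)
  qed
  from Liminf_mono[OF this]
  have "Liminf (at_right 0) f \<le> ereal (F t - c * t)"
    using \<open>ereal (F t - c * t) = _\<close> by simp
  moreover have "f 0 \<le> Liminf (at_right 0) f"
  proof -
    have "at (0::real) within {0..} = at_right 0"
      by (simp add: at_within_Ici_at_right)
    then show ?thesis
      using bspec[OF lsc[unfolded lsc_on_def], of 0] by simp
  qed
  ultimately have "f 0 \<le> ereal (F t - c * t)" by simp
  then show ?thesis
    using f_eq_F[OF assms(2)] f_nonneg[of 0] by (cases "f 0") auto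
qed

text \<open>If the maximizer is \<open>0\<close>, then \<open>s\<close> is at most the slope at
  \<open>0\<close>, and comparison with \<open>f 1 = 0\<close> gives
  \<open>f 0 \<le> - s\<close>.\<close>

lemma f_conj_deriv_finite: "f (conj_deriv s) = ereal (F (conj_deriv s))"
proof (cases "0 < conj_deriv s")
  case True
  then show ?thesis by (rule f_eq_F)
next
  case False
  then have 0: "conj_deriv s = 0" using conj_deriv_nonneg[of s] by simp
  then have "f 0 + ereal (s * 1) \<le> f 1"
    by (intro f_0_le) (simp_all add: conj_deriv_eq_0_iff)
  then have "f 0 \<noteq> \<infinity>" using f_1 by auto
  then show ?thesis
    using f_nonneg[of 0] unfolding 0 by (simp add: F_def ereal_real')
qed

text \<open>This is what makes \<open>conj_deriv s\<close> the unique maximizer of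
  \<open>s * t - f t\<close> over \<open>t \<ge> 0\<close>: the line of slope \<open>s\<close>
  touches the graph there and lies strictly below it elsewhere.\<close>

lemma f_above_support:
  assumes "t \<ge> 0" "t \<noteq> conj_deriv s"
  shows "ereal (F (conj_deriv s) + s * (t - conj_deriv s)) < f t"
proof (cases "0 < conj_deriv s")
  case True
  define u where "u = conj_deriv s"
  have u: "u > 0" "fprime f u = s" using True fprime_conj_deriv by (auto simp: u_def)
  have pos: "F u + s * (r - u) < F r" if "r > 0" "r \<noteq> u" for r
    using F_strictly_above_tangent[of u r] u that by auto
  show ?thesis
  proof (cases "t = 0")
    case True
    show ?thesis
    proof (cases "f 0 = \<infinity>")
      case False
      then have f0: "f 0 = ereal (F 0)"
        using f_nonneg[of 0] by (simp add: F_def ereal_real')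
      have "\<forall>x\<in>{0..}. \<forall>y\<in>{0..}. \<forall>a\<in>{0..1}.
          f ((1 - a) * x + a * y) \<le> ereal (1 - a) * f x + ereal a * f y"
        using convex by (simp add: ereal_convex_on_def)
      \<comment> \<open>Strict tangent inequalities are available only at positive points. The one
        at \<open>u / 2\<close> is combined with convexity on the segment from \<open>0\<close> to
        \<open>u\<close>, which uses the value of \<open>f\<close> at the boundary.\<close>
      from this[rule_format, of 0 u "1/2"]
      have "f (u / 2) \<le> ereal (1 / 2) * f 0 + ereal (1 / 2) * f u"
        using u by simp
      then have "F (u / 2) \<le> (F 0 + F u) / 2"
        using u by (simp add: f_eq_F f0)
      with pos[of "u / 2"] u True f0 show ?thesis
        by (simp add: u_def[symmetric] field_simps)
    qed (use True in simp)
  next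
    case False
    then show ?thesis
      using pos[of t] assms f_eq_F[of t] by (auto simp: u_def)
  qed
next
  case False
  then have 0: "conj_deriv s = 0" using conj_deriv_nonneg[of s] by simp
  with assms have t: "t > 0" by simp
  have F0: "f 0 = ereal (F 0)"
    using f_conj_deriv_finite[of s] unfolding 0 .
  have s: "ereal s \<le> fprime_at_0 f" using 0 by (simp add: conj_deriv_eq_0_iff)
  \<comment> \<open>The interval from \<open>0\<close> to \<open>t\<close> is split at
    \<open>t / 2\<close>: the boundary estimate covers the first half, and the tangent at
    \<open>t / 2\<close> supplies strictness on the second.\<close>
  then have "f 0 + ereal (s * (t / 2)) \<le> f (t / 2)"
    using t by (intro f_0_le) auto
  then have "F 0 + s * (t / 2) \<le> F (t / 2)"
    using f_eq_F[of "t/2"] t by (simp add: F0)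
  moreover have "F (t / 2) + fprime f (t / 2) * (t / 2) < F t"
    using F_strictly_above_tangent[of "t/2" t] t by simp
  moreover have "s * (t / 2) \<le> fprime f (t / 2) * (t / 2)"
    using slope_0_less_fprime[of "t/2"] t s
    by (intro mult_right_mono) (auto dest: le_less_trans)
  ultimately have "F 0 + s * t < F t" by (simp add: field_simps)
  then show ?thesis
    using 0 f_eq_F[OF t] by simp
qed

text \<open>On \<open>{0..}\<close>, \<open>f\<close> agrees with a function that is continuous on
  \<open>{0<..}\<close> and constant elsewhere; so nothing has to be known about \<open>f\<close> at
  negative arguments.\<close>

lemma borel_measurable_f_comp:
  assumes "u \<in> borel_measurable M" "\<And>z. z \<in> space M \<Longrightarrow> 0 \<le> u z"
  shows "(\<lambda>z. f (u z)) \<in> borel_measurable M"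
proof -
  define g where "g = (\<lambda>t. if t \<in> {0<..} then ereal (F t) else f 0)"
  have "continuous_on {0<..} F"
    by (intro continuous_at_imp_continuous_on ballI DERIV_isCont[OF has_real_derivative_F]) auto
  then have "g \<in> borel_measurable borel"
    unfolding g_def by (intro borel_measurable_continuous_on_if continuous_on_ereal) auto
  then have "(\<lambda>z. g (u z)) \<in> borel_measurable M"
    using assms(1) by (rule measurable_compose[rotated])
  moreover have "g (u z) = f (u z)" if "z \<in> space M" for z
    using assms(2)[OF that] f_eq_F[of "u z"] by (cases "u z = 0") (auto simp: g_def)
  ultimately show ?thesis
    by (simp cong: measurable_cong)
qed

end

subsection \<open>Normalization\<close>

locale regularized_problem = prob_space P + divergence_generator f
  for P :: "'a measure" and f :: "real \<Rightarrow> ereal" +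
  fixes \<alpha> :: real and l :: "'a \<Rightarrow> ereal"
  assumes \<alpha>_pos: "\<alpha> > 0"
    and l_measurable [measurable]: "l \<in> borel_measurable P"
    and l_not_MInfty: "z \<in> space P \<Longrightarrow> l z \<noteq> -\<infinity>"
    and l_integrable: "(\<integral>\<^sup>+ z. e2ennreal \<bar>l z\<bar> \<partial>P) < \<infinity>"
    and l_bounded_below: "\<exists>m::real. AE z in P. ereal m \<le> l z"
begin

text \<open>The default value \<open>0\<close> is taken where \<open>l z = \<infinity>\<close>, a
  null set.\<close>

definition L :: "'a \<Rightarrow> real" where
  "L z = real_of_ereal (l z)"

lemma L_measurable [measurable]: "L \<in> borel_measurable P"
  unfolding L_def by measurable

lemma l_eq_L: "z \<in> space P \<Longrightarrow> l z < \<infinity> \<Longrightarrow> l z = ereal (L z)"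
  using l_not_MInfty[of z] by (cases "l z") (auto simp: L_def)

lemma AE_l_finite: "AE z in P. l z < \<infinity>"
proof -
  have "AE z in P. e2ennreal \<bar>l z\<bar> \<noteq> \<infinity>"
    using l_integrable by (intro nn_integral_PInf_AE) auto
  then show ?thesis
    by eventually_elim auto
qed

lemma AE_l_eq_L: "AE z in P. l z = ereal (L z)"
  using AE_l_finite by (auto intro: l_eq_L elim!: AE_mp)

lemma integrable_L: "integrable P L"
proof (rule integrableI_bounded)
  have "(\<integral>\<^sup>+ z. ennreal (norm (L z)) \<partial>P) = (\<integral>\<^sup>+ z. e2ennreal \<bar>l z\<bar> \<partial>P)"
    using AE_l_eq_L by (intro nn_integral_cong_AE) (auto elim: eventually_mono)
  then show "(\<integral>\<^sup>+ z. ennreal (norm (L z)) \<partial>P) < \<infinity>"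
    using l_integrable by simp
qed measurable

definition m :: real where
  "m = (SOME m. AE z in P. ereal m \<le> l z)"

lemma AE_m_le_l: "AE z in P. ereal m \<le> l z"
  unfolding m_def using l_bounded_below by (rule someI_ex)

lemma AE_m_le_L: "AE z in P. m \<le> L z"
  using AE_m_le_l AE_l_eq_L by eventually_elim simp

section \<open>The pointwise minimizer\<close>

definition score :: "real \<Rightarrow> 'a \<Rightarrow> real" where
  "score lam z = - (L z + lam) / \<alpha>"

lemma score_measurable [measurable]: "score lam \<in> borel_measurable P"
  unfolding score_def by measurable

text \<open>The strict support inequality is multiplied by \<alpha>, using
  \<open>\<alpha> * score lam z = - (L z + lam)\<close>. The comparison stays in
  \<open>ereal\<close> because \<open>f t\<close> may be infinite at \<open>t = 0\<close>.\<close>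

lemma u_obj_less:
  assumes "z \<in> space P" "l z < \<infinity>" "t \<ge> 0" "t \<noteq> conj_deriv (score lam z)"
  shows "u_obj f \<alpha> l lam z (conj_deriv (score lam z)) < u_obj f \<alpha> l lam z t"
proof -
  define u where "u = conj_deriv (score lam z)"
  have lz: "l z = ereal (L z)" using assms by (intro l_eq_L)
  have fu: "f u = ereal (F u)" unfolding u_def by (rule f_conj_deriv_finite)
  have less: "ereal (F u + score lam z * (t - u)) < f t"
    unfolding u_def using assms by (intro f_above_support)
  have "ereal (\<alpha> * F u - (L z + lam) * (t - u)) = ereal \<alpha> * ereal (F u + score lam z * (t - u))"
    using \<alpha>_pos by (simp add: score_def field_simps)
  also have "\<dots> < ereal \<alpha> * f t"
    using less \<alpha>_pos by (intro ereal_mult_strict_left_mono) auto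
  finally have "ereal (\<alpha> * F u - (L z + lam) * (t - u)) < ereal \<alpha> * f t" .
  then have "ereal (\<alpha> * F u + (L z + lam) * u) < ereal \<alpha> * f t + ereal ((L z + lam) * t)"
    by (cases "ereal \<alpha> * f t") (auto simp: algebra_simps)
  then show ?thesis
    by (simp add: u_obj_def lz fu u_def[symmetric])
qed

lemma is_arg_min_u_obj_iff:
  assumes "z \<in> space P" "l z < \<infinity>"
  shows "is_arg_min (u_obj f \<alpha> l lam z) (\<lambda>t. t \<in> {0..}) t \<longleftrightarrow> t = conj_deriv (score lam z)"
proof
  assume t: "is_arg_min (u_obj f \<alpha> l lam z) (\<lambda>t. t \<in> {0..}) t"
  show "t = conj_deriv (score lam z)"
  proof (rule ccontr)
    assume "t \<noteq> conj_deriv (score lam z)"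
    then have "u_obj f \<alpha> l lam z (conj_deriv (score lam z)) < u_obj f \<alpha> l lam z t"
      using t by (intro u_obj_less[OF assms]) (auto simp: is_arg_min_def)
    then show False
      using t conj_deriv_nonneg[of "score lam z"] by (auto simp: is_arg_min_def)
  qed
next
  have "\<not> u_obj f \<alpha> l lam z r < u_obj f \<alpha> l lam z (conj_deriv (score lam z))" if "r \<ge> 0" for r
    using u_obj_less[OF assms that, of lam] by (cases "r = conj_deriv (score lam z)") auto
  then show "is_arg_min (u_obj f \<alpha> l lam z) (\<lambda>t. t \<in> {0..}) t" if "t = conj_deriv (score lam z)"
    using conj_deriv_nonneg[of "score lam z"] unfolding that by (simp add: is_arg_min_def)
qed

lemma u_fun_eq:
  assumes "z \<in> space P" "l z < \<infinity>"
  shows "u_fun f \<alpha> l lam z = conj_deriv (score lam z)"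
  using assms is_arg_min_u_obj_iff[OF assms, of lam]
  by (simp add: u_fun_def arg_min_on_def arg_min_def)

lemma u_fun_eq_if:
  assumes "z \<in> space P"
  shows "u_fun f \<alpha> l lam z = (if l z = \<infinity> then 0 else conj_deriv (score lam z))"
  using u_fun_eq[OF assms] by (auto simp: u_fun_def less_top)

lemma u_fun_measurable [measurable]: "u_fun f \<alpha> l lam \<in> borel_measurable P"
proof -
  have "(\<lambda>z. conj_deriv (score lam z)) \<in> borel_measurable P"
    by (intro measurable_compose[OF score_measurable borel_measurable_conj_deriv])
  then have "(\<lambda>z. if l z = \<infinity> then 0 else conj_deriv (score lam z)) \<in> borel_measurable P"
    by measurable
  then show ?thesis
    by (subst measurable_cong[OF u_fun_eq_if])
qed

lemma u_fun_nonneg: "z \<in> space P \<Longrightarrow> 0 \<le> u_fun f \<alpha> l lam z"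
  using conj_deriv_nonneg by (simp add: u_fun_eq_if)

lemma AE_u_fun_eq: "AE z in P. u_fun f \<alpha> l lam z = conj_deriv (score lam z)"
  using AE_l_finite AE_space by eventually_elim (rule u_fun_eq)

text \<open>The scores are a.e. at most \<open>- (m + c) / \<alpha>\<close>, as \<open>m\<close>
  bounds \<open>l\<close> from below. The bound is one constant for all \<open>lam \<ge> c\<close>,
  so it serves for domination.\<close>

lemma AE_u_fun_le:
  assumes "c \<le> lam"
  shows "AE z in P. norm (u_fun f \<alpha> l lam z) \<le> conj_deriv (- (m + c) / \<alpha>)"
  using AE_u_fun_eq[of lam] AE_m_le_L
proof eventually_elim
  case (elim z)
  have "score lam z \<le> - (m + c) / \<alpha>"
    using elim(2) assms \<alpha>_pos unfolding score_def by (intro divide_right_mono) auto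
  then show ?case
    using elim(1) conj_deriv_nonneg by (simp add: conj_deriv_mono)
qed

lemma integrable_u_fun: "integrable P (u_fun f \<alpha> l lam)"
  by (rule integrable_const_bound[OF AE_u_fun_le[OF order_refl]]) measurable

section \<open>The total mass as a function of the multiplier\<close>

definition mass :: "real \<Rightarrow> real" where
  "mass lam = (\<integral>z. u_fun f \<alpha> l lam z \<partial>P)"

lemma nn_integral_u_fun: "(\<integral>\<^sup>+ z. ennreal (u_fun f \<alpha> l lam z) \<partial>P) = ennreal (mass lam)"
  unfolding mass_def by (intro nn_integral_eq_integral integrable_u_fun AE_I2 u_fun_nonneg)

lemma nn_integral_u_fun_eq_1_iff:
  "(\<integral>\<^sup>+ z. ennreal (u_fun f \<alpha> l lam z) \<partial>P) = 1 \<longleftrightarrow> mass lam = 1"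
  by (simp add: nn_integral_u_fun)

lemma isCont_mass: "isCont mass lam"
  unfolding continuous_at_sequentially
proof (intro allI impI)
  fix X :: "nat \<Rightarrow> real" assume X: "X \<longlonglongrightarrow> lam"
  \<comment> \<open>A convergent sequence is bounded below, which yields a single dominating
    constant for all its members.\<close>
  then obtain c where c: "\<And>n. c \<le> X n"
    by (meson Bseq_eq_bounded bdd_below_def convergentI convergent_imp_Bseq rangeI Bseq_bdd_below)
  have "(\<lambda>n. \<integral>z. u_fun f \<alpha> l (X n) z \<partial>P) \<longlonglongrightarrow> (\<integral>z. u_fun f \<alpha> l lam z \<partial>P)"
  proof (rule integral_dominated_convergence)
    show "AE z in P. norm (u_fun f \<alpha> l (X n) z) \<le> conj_deriv (- (m + c) / \<alpha>)" for n
      by (rule AE_u_fun_le[OF c])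
    have "AE z in P. \<forall>n. u_fun f \<alpha> l (X n) z = conj_deriv (score (X n) z)"
      by (simp add: AE_all_countable AE_u_fun_eq)
    then show "AE z in P. (\<lambda>n. u_fun f \<alpha> l (X n) z) \<longlonglongrightarrow> u_fun f \<alpha> l lam z"
      using AE_u_fun_eq[of lam]
    proof eventually_elim
      case (elim z)
      have "(\<lambda>n. score (X n) z) \<longlonglongrightarrow> score lam z"
        unfolding score_def using \<alpha>_pos by (intro tendsto_intros X) auto
      then show ?case
        unfolding elim(2) elim(1)[rule_format] by (rule isCont_tendsto_compose[OF isCont_conj_deriv])
    qed
  qed measurable
  then show "(mass \<circ> X) \<longlonglongrightarrow> mass lam"
    by (simp add: mass_def comp_def)
qed

lemma AE_u_fun_antimono:
  assumes "a \<le> b"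
  shows "AE z in P. u_fun f \<alpha> l b z \<le> u_fun f \<alpha> l a z"
  using AE_u_fun_eq[of a] AE_u_fun_eq[of b]
proof eventually_elim
  case (elim z)
  have "score b z \<le> score a z"
    using assms \<alpha>_pos unfolding score_def by (intro divide_right_mono) auto
  then show ?case
    using elim by (simp add: conj_deriv_mono)
qed

lemma mass_antimono: "a \<le> b \<Longrightarrow> mass b \<le> mass a"
  unfolding mass_def by (intro integral_mono_AE integrable_u_fun AE_u_fun_antimono)

text \<open>Ordered functions with equal integrals agree a.e. But wherever the larger one is
  positive, the inequality is strict; hence it vanishes a.e., which contradicts mass
  \<open>1\<close>.\<close>

lemma mass_inj:
  assumes "a < b" "mass a = 1" "mass b = 1"
  shows False
proof -
  have "(\<integral>z. u_fun f \<alpha> l a z - u_fun f \<alpha> l b z \<partial>P) = 0"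
    using assms integrable_u_fun by (simp add: mass_def)
  moreover have "AE z in P. 0 \<le> u_fun f \<alpha> l a z - u_fun f \<alpha> l b z"
    using AE_u_fun_antimono[of a b] assms(1) by simp
  ultimately have "AE z in P. u_fun f \<alpha> l a z - u_fun f \<alpha> l b z = 0"
    using integrable_u_fun by (subst (asm) integral_nonneg_eq_0_iff_AE) auto
  then have "AE z in P. u_fun f \<alpha> l a z = 0"
    using AE_u_fun_eq[of a] AE_u_fun_eq[of b]
  proof eventually_elim
    case (elim z)
    have "score b z < score a z"
      using assms(1) \<alpha>_pos unfolding score_def by (intro divide_strict_right_mono) auto
    then show ?case
      using conj_deriv_strict_mono[of "score b z" "score a z"] conj_deriv_nonneg[of "score a z"] elim
      by fastforce
  qed
  then have "mass a = 0"
    unfolding mass_def by (rule integral_eq_zero_AE)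
  with assms(2) show False by simp
qed

lemma ex_mass_le_1: "\<exists>lam. mass lam \<le> 1"
proof -
  \<comment> \<open>Chosen so that the upper bound for the scores is \<open>fprime f 1 - 1\<close>;
    being below \<open>fprime f 1\<close>, it forces the minimizer below \<open>1\<close>.\<close>
  define lam where "lam = - \<alpha> * (fprime f 1 - 1) - m"
  have "- (m + lam) / \<alpha> = fprime f 1 - 1"
    using \<alpha>_pos by (simp add: lam_def)
  then have "conj_deriv (- (m + lam) / \<alpha>) \<le> 1"
    using conj_deriv_less_iff[of 1 "fprime f 1 - 1"] by simp
  then have "AE z in P. u_fun f \<alpha> l lam z \<le> 1"
    using AE_u_fun_le[OF order_refl, of lam] by (auto elim!: eventually_mono)
  then have "mass lam \<le> (\<integral>z. 1 \<partial>P)"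
    unfolding mass_def by (intro integral_mono_AE integrable_u_fun) auto
  then show ?thesis by (auto simp: prob_space)
qed

text \<open>The bound is integrated from \<open>u \<ge> 2 (1 - \<bar>L\<bar> / N)\<close>, which holds where \<open>L \<le> N\<close> as
  \<open>u \<ge> 2\<close> there, and elsewhere as \<open>u \<ge> 0\<close>.\<close>

lemma ex_mass_ge_1: "\<exists>lam. 1 \<le> mass lam"
proof -
  \<comment> \<open>The factor \<open>2\<close> makes the mean of \<open>\<bar>L\<bar> / N\<close>
    at most \<open>1 / 2\<close>, so that the lower bound integrates to at least \<open>1\<close>;
    the summand \<open>1\<close> keeps \<open>N\<close> positive.\<close>
  define N where "N = 2 * (\<integral>z. \<bar>L z\<bar> \<partial>P) + 1"
  have "0 \<le> (\<integral>z. \<bar>L z\<bar> \<partial>P)" by simp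
  then have N: "N > 0" unfolding N_def by linarith
  \<comment> \<open>With this choice the score at a point with \<open>L z = N\<close> is exactly
    \<open>fprime f 2\<close>, where the minimizer equals \<open>2\<close>.\<close>
  define lam where "lam = - \<alpha> * fprime f 2 - N"
  have lam: "fprime f 2 = - (N + lam) / \<alpha>"
    using \<alpha>_pos by (simp add: lam_def)
  have "AE z in P. 2 * (1 - \<bar>L z\<bar> / N) \<le> u_fun f \<alpha> l lam z"
    using AE_u_fun_eq[of lam]
  proof eventually_elim
    case (elim z)
    show ?case
    proof (cases "L z \<le> N")
      case True
      then have "fprime f 2 \<le> score lam z"
        using \<alpha>_pos unfolding lam score_def by (intro divide_right_mono) auto
      then have "2 \<le> conj_deriv (score lam z)"
        using conj_deriv_less_iff[of 2 "score lam z"] by simp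
      moreover have "0 \<le> \<bar>L z\<bar> / N" using N by simp
      ultimately show ?thesis unfolding elim by argo
    next
      case False
      then have "1 \<le> \<bar>L z\<bar> / N" using N by simp
      then show ?thesis
        unfolding elim using conj_deriv_nonneg[of "score lam z"] by argo
    qed
  qed
  then have "(\<integral>z. 2 * (1 - \<bar>L z\<bar> / N) \<partial>P) \<le> mass lam"
    unfolding mass_def using integrable_L by (intro integral_mono_AE integrable_u_fun) auto
  moreover have "(\<integral>z. 2 * (1 - \<bar>L z\<bar> / N) \<partial>P) = 2 * (1 - (\<integral>z. \<bar>L z\<bar> \<partial>P) / N)"
    using integrable_L by (simp add: prob_space)
  moreover have "(\<integral>z. \<bar>L z\<bar> \<partial>P) / N \<le> 1 / 2"
    using N by (simp add: field_simps N_def)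
  ultimately show ?thesis by (intro exI[of _ lam]) argo
qed

lemma ex1_mass_eq_1: "\<exists>!lam. mass lam = 1"
proof -
  obtain a b where ab: "1 \<le> mass a" "mass b \<le> 1"
    using ex_mass_ge_1 ex_mass_le_1 by blast
  have "\<exists>lam. mass lam = 1"
  proof (cases "a \<le> b")
    case True
    then show ?thesis
      using IVT2[of mass b 1 a] ab isCont_mass by blast
  next
    \<comment> \<open>Here \<open>b < a\<close>, so monotonicity gives
      \<open>mass a \<le> mass b \<le> 1\<close>, and \<open>a\<close> itself is a solution.\<close>
    case False
    then show ?thesis
      using mass_antimono[of b a] ab by (intro exI[of _ a]) auto
  qed
  then show ?thesis
    using mass_inj by (metis linorder_neqE)
qed

subsection \<open>The variational problem\<close>

lemma feasibleD:
  assumes "u \<in> feasible_densities P"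
  shows "u \<in> borel_measurable P" "z \<in> space P \<Longrightarrow> 0 \<le> u z"
    "(\<integral>\<^sup>+ z. ennreal (u z) \<partial>P) = 1" "integrable P u" "(\<integral>z. u z \<partial>P) = 1"
proof -
  show u: "u \<in> borel_measurable P" "(\<integral>\<^sup>+ z. ennreal (u z) \<partial>P) = 1"
    and nonneg: "z \<in> space P \<Longrightarrow> 0 \<le> u z" for z
    using assms by (auto simp: feasible_densities_def)
  show "integrable P u" "(\<integral>z. u z \<partial>P) = 1"
    using nn_integral_eq_integrable[OF u(1), of 1] nonneg u(2) by auto
qed

text \<open>The negative part is a.e. at most \<open>\<bar>m\<bar> * u\<close>, which has integral
  \<open>\<bar>m\<bar>\<close> because \<open>u\<close> is a density.\<close>

lemma l_times_u_defined:
  assumes u: "u \<in> feasible_densities P"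
  shows "ext_integral_defined P (\<lambda>z. l z * ereal (u z))"
proof -
  note [measurable] = feasibleD(1)[OF u]
  have "(\<integral>\<^sup>+ z. e2ennreal (- (l z * ereal (u z))) \<partial>P) \<le> (\<integral>\<^sup>+ z. ennreal \<bar>m\<bar> * ennreal (u z) \<partial>P)"
  proof (rule nn_integral_mono_AE)
    show "AE z in P. e2ennreal (- (l z * ereal (u z))) \<le> ennreal \<bar>m\<bar> * ennreal (u z)"
      using AE_l_eq_L AE_m_le_L AE_space
    proof eventually_elim
      case (elim z)
      then have "- (L z * u z) \<le> \<bar>m\<bar> * u z"
        using mult_right_mono[of "- L z" "\<bar>m\<bar>" "u z"] feasibleD(2)[OF u] by auto
      then show ?case
        using elim(1) by (simp add: ennreal_mult[symmetric] feasibleD(2)[OF u elim(3)] ennreal_leI)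
    qed
  qed
  also have "\<dots> = ennreal \<bar>m\<bar>"
    using feasibleD(3)[OF u] by (simp add: nn_integral_cmult)
  also have "\<dots> < \<infinity>" by simp
  finally show ?thesis by (simp add: ext_integral_defined_def)
qed

lemma f_comp_nonneg: "u \<in> feasible_densities P \<Longrightarrow> z \<in> space P \<Longrightarrow> 0 \<le> f (u z)"
  by (intro f_nonneg feasibleD(2))

lemma f_comp_measurable: "u \<in> feasible_densities P \<Longrightarrow> (\<lambda>z. f (u z)) \<in> borel_measurable P"
  by (intro borel_measurable_f_comp feasibleD)

lemma density_integrand_defined:
  assumes "u \<in> feasible_densities P"
  shows "ext_integral_defined P (density_integrand f \<alpha> l u)"
proof -
  have [measurable]: "(\<lambda>z. f (u z)) \<in> borel_measurable P"
    using assms by (rule f_comp_measurable)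
  show ?thesis
    unfolding density_integrand_def
    using assms \<alpha>_pos f_comp_nonneg by (intro ext_integral_add_nonneg l_times_u_defined) auto
qed

lemma density_objective_eq:
  assumes "u \<in> feasible_densities P"
  shows "density_objective f \<alpha> P l u =
    ext_integral P (\<lambda>z. l z * ereal (u z)) + ereal \<alpha> * ext_integral P (\<lambda>z. f (u z))"
proof -
  have [measurable]: "(\<lambda>z. f (u z)) \<in> borel_measurable P"
    using assms by (rule f_comp_measurable)
  have "density_objective f \<alpha> P l u =
      ext_integral P (\<lambda>z. l z * ereal (u z)) + ext_integral P (\<lambda>z. ereal \<alpha> * f (u z))"
    unfolding density_objective_def density_integrand_def
    using assms \<alpha>_pos f_comp_nonneg by (intro ext_integral_add_nonneg l_times_u_defined) auto
  also have "ext_integral P (\<lambda>z. ereal \<alpha> * f (u z)) = ereal \<alpha> * ext_integral P (\<lambda>z. f (u z))"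
    using assms \<alpha>_pos f_comp_nonneg by (intro ext_integral_cmult_nonneg) auto
  finally show ?thesis .
qed

section \<open>Correspondence between densities and probability measures\<close>

lemma absolutely_continuous_density_u:
  assumes [measurable]: "u \<in> borel_measurable P"
  shows "absolutely_continuous P (density P (\<lambda>z. ennreal (u z)))"
  by (intro absolutely_continuousI_density) measurable

lemma measure_objective_density:
  assumes u: "u \<in> feasible_densities P"
  shows "measure_objective f \<alpha> P l (density P (\<lambda>z. ennreal (u z))) = density_objective f \<alpha> P l u"
proof -
  note [measurable] = feasibleD(1)[OF u]
  let ?Q = "density P (\<lambda>z. ennreal (u z))"
  have "AE z in P. ennreal (u z) = RN_deriv P ?Q z"
    by (rule RN_deriv_unique) auto
  then have "AE z in P. f (enn2real (RN_deriv P ?Q z)) = f (u z)"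
    using AE_space
  proof eventually_elim
    case (elim z)
    then show ?case
      using feasibleD(2)[OF u elim(2)] by (simp flip: elim(1))
  qed
  then have "f_divergence f ?Q P = ext_integral P (\<lambda>z. f (u z))"
    using absolutely_continuous_density_u[OF feasibleD(1)[OF u]]
    by (simp add: f_divergence_def ext_integral_cong_AE)
  moreover have "ext_integral ?Q l = ext_integral P (\<lambda>z. l z * ereal (u z))"
    using feasibleD(2)[OF u] by (intro ext_integral_density) auto
  ultimately show ?thesis
    by (simp add: measure_objective_def density_objective_eq[OF u])
qed

lemma density_in_prob_algebra:
  assumes u: "u \<in> feasible_densities P"
  shows "density P (\<lambda>z. ennreal (u z)) \<in> space (prob_algebra P)"
proof -
  note [measurable] = feasibleD(1)[OF u]
  have "prob_space (density P (\<lambda>z. ennreal (u z)))"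
    using feasibleD(3)[OF u]
    by (intro prob_spaceI) (simp add: emeasure_density cong: nn_integral_cong)
  then show ?thesis by (simp add: space_prob_algebra)
qed

text \<open>The Radon-Nikodym derivative is a.e. finite, so its real version, nonnegative
  everywhere, has the same density measure. The explicit form of \<open>u\<close> matches the
  integrand of \<open>f_divergence\<close>.\<close>

lemma absolutely_continuousE:
  assumes "Q \<in> space (prob_algebra P)" "absolutely_continuous P Q"
  obtains u where "u \<in> feasible_densities P" "Q = density P (\<lambda>z. ennreal (u z))"
    "u = (\<lambda>z. enn2real (RN_deriv P Q z))"
proof -
  have Q: "prob_space Q" "sets Q = sets P"
    using assms by (auto simp: space_prob_algebra)
  interpret Q: prob_space Q by fact
  define u where "u = (\<lambda>z. enn2real (RN_deriv P Q z))"
  have [measurable]: "u \<in> borel_measurable P"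
    unfolding u_def by measurable
  have "AE z in P. RN_deriv P Q z \<noteq> \<infinity>"
    using assms(2) Q(2) by (intro RN_deriv_finite Q.sigma_finite_measure_axioms)
  then have "AE z in P. ennreal (u z) = RN_deriv P Q z"
    by eventually_elim (simp add: u_def less_top)
  then have "density P (\<lambda>z. ennreal (u z)) = density P (RN_deriv P Q)"
    by (intro density_cong) auto
  also have "\<dots> = Q"
    using assms(2) Q(2) by (rule density_RN_deriv)
  finally have Q_eq: "Q = density P (\<lambda>z. ennreal (u z))" by simp
  have "(\<integral>\<^sup>+ z. ennreal (u z) \<partial>P) = emeasure (density P (\<lambda>z. ennreal (u z))) (space P)"
    by (simp add: emeasure_density cong: nn_integral_cong)
  also have "\<dots> = 1"
    using Q.emeasure_space_1 sets_eq_imp_space_eq[OF Q(2)] by (simp flip: Q_eq)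
  finally have "u \<in> feasible_densities P"
    by (simp add: feasible_densities_def) (simp add: u_def)
  then show ?thesis using Q_eq that u_def by blast
qed

lemma measure_objective_not_absolutely_continuous:
  "\<not> absolutely_continuous P Q \<Longrightarrow> measure_objective f \<alpha> P l Q = \<infinity>"
  using \<alpha>_pos by (simp add: measure_objective_def f_divergence_def)

end

section \<open>Optimality and uniqueness at a normalizing multiplier\<close>

locale normalized_problem = regularized_problem +
  fixes lam :: real
  assumes mass_eq_1: "mass lam = 1"
begin

abbreviation w :: "'a \<Rightarrow> real" where
  "w \<equiv> u_fun f \<alpha> l lam"

lemma w_feasible: "w \<in> feasible_densities P"
  using mass_eq_1 u_fun_nonneg
  by (simp add: feasible_densities_def nn_integral_u_fun)

definition G :: "'a \<Rightarrow> real" where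
  "G z = L z * w z + \<alpha> * F (w z)"

lemma AE_density_integrand_w: "AE z in P. density_integrand f \<alpha> l w z = ereal (G z)"
  using AE_l_eq_L AE_u_fun_eq[of lam]
proof eventually_elim
  case (elim z)
  then show ?case
    using f_conj_deriv_finite[of "score lam z"] by (simp add: density_integrand_def G_def)
qed

text \<open>Pointwise optimality of \<open>w z\<close> for \<open>u_obj\<close>, with the multiplier
  terms collected on one side. These have integral zero when \<open>v\<close> is a density.\<close>

lemma AE_density_integrand_greater:
  assumes v: "v \<in> feasible_densities P"
  shows "AE z in P. v z \<noteq> w z \<longrightarrow>
    ereal (G z + lam * (w z - v z)) < density_integrand f \<alpha> l v z"
  using AE_l_eq_L AE_density_integrand_w AE_space
proof eventually_elim
  case (elim z)
  show ?case
  proof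
    assume "v z \<noteq> w z"
    have "l z < \<infinity>" using elim(1) by simp
    then have "u_obj f \<alpha> l lam z (w z) < u_obj f \<alpha> l lam z (v z)"
      using \<open>v z \<noteq> w z\<close> elim(3) feasibleD(2)[OF v elim(3)] u_obj_less[of z "v z" lam]
      by (simp add: u_fun_eq)
    moreover have "u_obj f \<alpha> l lam z t = l z * ereal t + ereal \<alpha> * f t + ereal (lam * t)" for t
      unfolding u_obj_def elim(1)
      by (cases "ereal \<alpha> * f t") (auto simp: algebra_simps)
    ultimately have "density_integrand f \<alpha> l w z + ereal (lam * w z)
        < density_integrand f \<alpha> l v z + ereal (lam * v z)"
      by (simp add: density_integrand_def)
    then show "ereal (G z + lam * (w z - v z)) < density_integrand f \<alpha> l v z"
      unfolding elim(2) by (cases "density_integrand f \<alpha> l v z") (auto simp: algebra_simps)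
  qed
qed

lemma AE_density_integrand_ge:
  assumes v: "v \<in> feasible_densities P"
  shows "AE z in P. ereal (G z + lam * (w z - v z)) \<le> density_integrand f \<alpha> l v z"
  using AE_density_integrand_greater[OF v] AE_density_integrand_w
proof eventually_elim
  case (elim z)
  then show ?case
    by (cases "v z = w z") (auto simp: density_integrand_def)
qed

lemma const_1_feasible: "(\<lambda>z. 1) \<in> feasible_densities P"
  by (simp add: feasible_densities_def emeasure_space_1)

text \<open>Comparison with the density \<open>1\<close>, whose objective \<open>\<integral> l dP\<close> is finite, bounds \<open>G\<close> from
  above; from below it is bounded by \<open>m w\<close>.\<close>

lemma integrable_G: "integrable P G"
proof (rule Bochner_Integration.integrable_bound)
  show "integrable P (\<lambda>z. \<bar>L z\<bar> + \<bar>lam\<bar> * (1 + w z) + \<bar>m\<bar> * w z)"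
    using integrable_L integrable_u_fun by simp
  show "G \<in> borel_measurable P"
    using borel_measurable_real_of_ereal[OF f_comp_measurable[OF w_feasible]]
    unfolding G_def F_def by measurable
  show "AE z in P. norm (G z) \<le> norm (\<bar>L z\<bar> + \<bar>lam\<bar> * (1 + w z) + \<bar>m\<bar> * w z)"
    using AE_density_integrand_ge[OF const_1_feasible] AE_l_eq_L AE_m_le_L AE_space
      AE_density_integrand_w
  proof eventually_elim
    case (elim z)
    have w: "0 \<le> w z" using elim(4) by (rule u_fun_nonneg)
    \<comment> \<open>The density \<open>1\<close> has integrand \<open>L z\<close>, because
      \<open>f 1 = 0\<close>.\<close>
    have "G z + lam * (w z - 1) \<le> L z"
      using elim(1,2) by (simp add: density_integrand_def f_1)
    moreover have "lam * (1 - w z) \<le> \<bar>lam\<bar> * \<bar>1 - w z\<bar>"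
      by (metis abs_ge_self abs_mult)
    moreover have "\<bar>lam\<bar> * \<bar>1 - w z\<bar> \<le> \<bar>lam\<bar> * (1 + w z)"
      using w by (intro mult_left_mono) auto
    moreover have "m * w z \<le> L z * w z"
      using elim(3) w by (intro mult_right_mono)
    moreover have "- (m * w z) \<le> \<bar>m\<bar> * w z"
      using w mult_right_mono[of "- m" "\<bar>m\<bar>" "w z"] by auto
    moreover have "0 \<le> \<alpha> * F (w z)"
      using \<alpha>_pos f_nonneg[OF w] by (simp add: F_def real_of_ereal_pos)
    moreover have "0 \<le> \<bar>lam\<bar> * (1 + w z)" "0 \<le> \<bar>m\<bar> * w z" using w by simp_all
    ultimately show ?case
      unfolding G_def real_norm_def by (smt (verit) mult_minus_right right_diff_distrib)
  qed
qed

lemma density_objective_w: "density_objective f \<alpha> P l w = ereal (\<integral>z. G z \<partial>P)"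
  unfolding density_objective_def
  by (simp add: ext_integral_cong_AE[OF AE_density_integrand_w] ext_integral_ereal integrable_G)

text \<open>Gives minimality and uniqueness at once: a competitor that is no worse than
  \<open>w\<close> coincides with it a.e.\<close>

lemma density_objective_le_imp_AE_eq:
  assumes v: "v \<in> feasible_densities P"
    and le: "density_objective f \<alpha> P l v \<le> density_objective f \<alpha> P l w"
  shows "AE z in P. v z = w z"
proof -
  define H where "H z = real_of_ereal (density_integrand f \<alpha> l v z)" for z
  \<comment> \<open>The value at \<open>w\<close> is finite, hence so is that at \<open>v\<close>,
    and the integrand of \<open>v\<close> may be replaced by an integrable real function.\<close>
  have "ext_integral P (density_integrand f \<alpha> l v) \<noteq> \<infinity>"
    using le unfolding density_objective_w by (auto simp: density_objective_def)
  note H = ext_integral_defined_finiteD[OF density_integrand_defined[OF v] this, folded H_def]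
  have "density_objective f \<alpha> P l v = ereal (\<integral>z. H z \<partial>P)"
    unfolding density_objective_def
    by (simp add: ext_integral_cong_AE[OF H(1)] ext_integral_ereal H(2))
  with le have le': "(\<integral>z. H z \<partial>P) \<le> (\<integral>z. G z \<partial>P)"
    by (simp add: density_objective_w)
  \<comment> \<open>The pointwise optimality gap: nonnegative a.e., and positive a.e. where
    \<open>v\<close> and \<open>w\<close> differ. As \<open>v\<close> and \<open>w\<close> both have
    mass \<open>1\<close>, its integral is the difference of the objectives, which is at most
    \<open>0\<close>.\<close>
  define D where "D = (\<lambda>z. H z - (G z + lam * (w z - v z)))"
  note int = H(2) integrable_G feasibleD(4)[OF v] feasibleD(4)[OF w_feasible]
  have "integrable P D"
    unfolding D_def using int by simp
  moreover have nonneg: "AE z in P. 0 \<le> D z"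
    using AE_density_integrand_ge[OF v] H(1)
    by eventually_elim (metis D_def diff_ge_0_iff_ge ereal_less_eq(3))
  moreover have "(\<integral>z. D z \<partial>P) = (\<integral>z. H z \<partial>P) - (\<integral>z. G z \<partial>P)"
    unfolding D_def using int feasibleD(5)[OF v] feasibleD(5)[OF w_feasible] by simp
  then have "(\<integral>z. D z \<partial>P) = 0"
    using le' integral_nonneg_AE[OF nonneg] by linarith
  ultimately have "AE z in P. D z = 0"
    using integral_nonneg_eq_0_iff_AE by blast
  then show ?thesis
    using AE_density_integrand_greater[OF v] H(1)
  proof eventually_elim
    case (elim z)
    show ?case
    proof (rule ccontr)
      assume "v z \<noteq> w z"
      then have "ereal (G z + lam * (w z - v z)) < ereal (H z)"
        using elim(2,3) by simp
      with elim(1) show False by (simp add: D_def)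
    qed
  qed
qed

lemma density_objective_cong_AE:
  "AE z in P. u z = v z \<Longrightarrow> density_objective f \<alpha> P l u = density_objective f \<alpha> P l v"
  unfolding density_objective_def
  by (intro ext_integral_cong_AE) (auto simp: density_integrand_def elim: eventually_mono)

text \<open>A strictly better density would agree with \<open>w\<close> a.e. and so have the same
  objective.\<close>

lemma w_is_arg_min:
  "is_arg_min (density_objective f \<alpha> P l) (\<lambda>u. u \<in> feasible_densities P) w"
  unfolding is_arg_min_def
proof (intro conjI w_feasible notI, elim exE conjE)
  fix v
  assume v: "v \<in> feasible_densities P" "density_objective f \<alpha> P l v < density_objective f \<alpha> P l w"
  then have "AE z in P. v z = w z"
    by (intro density_objective_le_imp_AE_eq) auto
  from density_objective_cong_AE[OF this] v(2) show False by simp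
qed

lemma arg_min_AE_unique:
  assumes "is_arg_min (density_objective f \<alpha> P l) (\<lambda>u. u \<in> feasible_densities P) v"
  shows "AE z in P. v z = w z"
  using assms w_feasible
  by (intro density_objective_le_imp_AE_eq) (auto simp: is_arg_min_def not_less)

lemma measure_arg_min_iff:
  "is_arg_min (measure_objective f \<alpha> P l) (\<lambda>Q. Q \<in> space (prob_algebra P)) Q \<longleftrightarrow>
    Q = density P (\<lambda>z. ennreal (w z))"
proof
  let ?W = "density P (\<lambda>z. ennreal (w z))"
  have W: "?W \<in> space (prob_algebra P)"
    "measure_objective f \<alpha> P l ?W = density_objective f \<alpha> P l w"
    using w_feasible by (rule density_in_prob_algebra, rule measure_objective_density)
  \<comment> \<open>The objective of \<open>?W\<close> is finite, so a measure that is no worse is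
    absolutely continuous, and the uniqueness of densities applies. Both directions of the
    equivalence follow from this.\<close>
  have *: "R = ?W" if R: "R \<in> space (prob_algebra P)"
    "measure_objective f \<alpha> P l R \<le> measure_objective f \<alpha> P l ?W" for R
  proof -
    have "absolutely_continuous P R"
      using R(2) measure_objective_not_absolutely_continuous[of R]
      unfolding W(2) density_objective_w by fastforce
    then obtain v where v: "v \<in> feasible_densities P" "R = density P (\<lambda>z. ennreal (v z))"
      using R(1) absolutely_continuousE by blast
    then have "AE z in P. v z = w z"
      using R(2) by (intro density_objective_le_imp_AE_eq) (simp_all add: measure_objective_density w_feasible)
    then show ?thesis
      unfolding v(2) using feasibleD(1)[OF v(1)]
      by (intro density_cong) (auto elim: eventually_mono)
  qed
  show "Q = ?W"
    if "is_arg_min (measure_objective f \<alpha> P l) (\<lambda>Q. Q \<in> space (prob_algebra P)) Q"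
    using that W(1) by (intro *) (auto simp: is_arg_min_def not_less)
  show "is_arg_min (measure_objective f \<alpha> P l) (\<lambda>Q. Q \<in> space (prob_algebra P)) Q" if "Q = ?W"
    unfolding that is_arg_min_def using W(1) * by (metis less_imp_le less_irrefl)
qed

end

theorem theorem1:
  fixes P :: "'a measure" and \<alpha> :: real and l :: "'a \<Rightarrow> ereal" and f :: "real \<Rightarrow> ereal"
  assumes "prob_space P"
    and "\<alpha> > 0"
    and "l \<in> borel_measurable P"
    and "\<forall>z\<in>space P. l z \<noteq> -\<infinity>"
    and "(\<integral>\<^sup>+ z. e2ennreal \<bar>l z\<bar> \<partial>P) < \<infinity>"
    and "\<exists>m::real. AE z in P. ereal m \<le> l z"
    and "proper_on {0..} f"
    and "lsc_on {0..} f"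
    and "ereal_convex_on {0..} f"
    and "\<forall>t>0. \<bar>f t\<bar> \<noteq> \<infinity>"
    and "\<forall>t>0. (\<lambda>s. real_of_ereal (f s)) differentiable (at t)"
    and "ereal_strictly_convex_on {0<..} f"
    and "f 1 = 0"
    and "\<forall>t\<ge>0. 0 \<le> f t \<and> (f t = 0 \<longrightarrow> t = 1)"
    and "((\<lambda>t. ereal (fprime f t)) \<longlongrightarrow> fprime_at_0 f) (at_right 0)"
    and "fprime_at_0 f < \<infinity>"
    and "filterlim (fprime f) at_top at_top"
  shows
    "strict_mono_on {0<..} (fprime f) \<and>
     bij_betw (fprime f) {0<..} {s. fprime_at_0 f < ereal s} \<and>
     (AE z in P. l z < \<infinity>) \<and>
     (\<forall>lam::real.
        (\<forall>z\<in>space P. l z < \<infinity> \<longrightarrow>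
           (\<exists>!t. is_arg_min (u_obj f \<alpha> l lam z) (\<lambda>t. t \<in> {0..}) t) \<and>
           u_fun f \<alpha> l lam z =
             (let s = - (real_of_ereal (l z) + lam) / \<alpha>
              in if ereal s \<le> fprime_at_0 f then 0 else fprime_inv f s)) \<and>
        u_fun f \<alpha> l lam \<in> borel_measurable P) \<and>
     (\<forall>u\<in>feasible_densities P. ext_integral_defined P (density_integrand f \<alpha> l u)) \<and>
     (\<forall>Q\<in>space (prob_algebra P). absolutely_continuous P Q \<longrightarrow>
        ext_integral_defined Q l \<and>
        ext_integral_defined P (\<lambda>z. f (enn2real (RN_deriv P Q z)))) \<and>
     (\<forall>u\<in>feasible_densities P.
        measure_objective f \<alpha> P l (density P (\<lambda>z. ennreal (u z))) =
        density_objective f \<alpha> P l u) \<and>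
     (\<exists>!lam::real. (\<integral>\<^sup>+ z. ennreal (u_fun f \<alpha> l lam z) \<partial>P) = 1) \<and>
     (\<forall>lam::real. (\<integral>\<^sup>+ z. ennreal (u_fun f \<alpha> l lam z) \<partial>P) = 1 \<longrightarrow>
        is_arg_min (density_objective f \<alpha> P l) (\<lambda>u. u \<in> feasible_densities P)
          (u_fun f \<alpha> l lam) \<and>
        (\<forall>v. is_arg_min (density_objective f \<alpha> P l) (\<lambda>u. u \<in> feasible_densities P) v \<longrightarrow>
           (AE z in P. v z = u_fun f \<alpha> l lam z)) \<and>
        (\<forall>Q. is_arg_min (measure_objective f \<alpha> P l) (\<lambda>Q. Q \<in> space (prob_algebra P)) Q \<longleftrightarrow>
           Q = density P (\<lambda>z. ennreal (u_fun f \<alpha> l lam z))))"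
proof -
  interpret regularized_problem P f \<alpha> l
    unfolding regularized_problem_def regularized_problem_axioms_def divergence_generator_def
    using assms by blast
  show ?thesis
    \<comment> \<open>The normalization condition becomes the real equation
      \<open>mass lam = 1\<close>.\<close>
    unfolding nn_integral_u_fun_eq_1_iff
  proof (intro conjI)
    show "\<forall>lam::real.
        (\<forall>z\<in>space P. l z < \<infinity> \<longrightarrow>
           (\<exists>!t. is_arg_min (u_obj f \<alpha> l lam z) (\<lambda>t. t \<in> {0..}) t) \<and>
           u_fun f \<alpha> l lam z =
             (let s = - (real_of_ereal (l z) + lam) / \<alpha>
              in if ereal s \<le> fprime_at_0 f then 0 else fprime_inv f s)) \<and>
        u_fun f \<alpha> l lam \<in> borel_measurable P"
    proof (intro allI conjI ballI impI u_fun_measurable)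
      fix lam :: real and z assume z: "z \<in> space P" "l z < \<infinity>"
      show "\<exists>!t. is_arg_min (u_obj f \<alpha> l lam z) (\<lambda>t. t \<in> {0..}) t"
        unfolding is_arg_min_u_obj_iff[OF z] by simp
      show "u_fun f \<alpha> l lam z =
          (let s = - (real_of_ereal (l z) + lam) / \<alpha>
           in if ereal s \<le> fprime_at_0 f then 0 else fprime_inv f s)"
        unfolding u_fun_eq[OF z] conj_deriv_def score_def L_def Let_def ..
    qed
    show "\<forall>Q\<in>space (prob_algebra P). absolutely_continuous P Q \<longrightarrow>
        ext_integral_defined Q l \<and>
        ext_integral_defined P (\<lambda>z. f (enn2real (RN_deriv P Q z)))"
    proof (intro ballI impI)
      fix Q assume "Q \<in> space (prob_algebra P)" "absolutely_continuous P Q"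
      then obtain u where u: "u \<in> feasible_densities P" "Q = density P (\<lambda>z. ennreal (u z))"
        "u = (\<lambda>z. enn2real (RN_deriv P Q z))"
        by (rule absolutely_continuousE)
      have "ext_integral_defined Q l"
        unfolding u(2) using u(1) feasibleD(1,2)[OF u(1)] l_times_u_defined
        by (subst ext_integral_defined_density_iff) auto
      moreover have "ext_integral_defined P (\<lambda>z. f (u z))"
        using f_comp_measurable[OF u(1)] f_comp_nonneg[OF u(1)]
        by (rule ext_integral_defined_nonneg)
      ultimately show "ext_integral_defined Q l \<and>
          ext_integral_defined P (\<lambda>z. f (enn2real (RN_deriv P Q z)))"
        by (simp add: u(3))
    qed
    show "\<forall>lam::real. mass lam = 1 \<longrightarrow>
        is_arg_min (density_objective f \<alpha> P l) (\<lambda>u. u \<in> feasible_densities P)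
          (u_fun f \<alpha> l lam) \<and>
        (\<forall>v. is_arg_min (density_objective f \<alpha> P l) (\<lambda>u. u \<in> feasible_densities P) v \<longrightarrow>
           (AE z in P. v z = u_fun f \<alpha> l lam z)) \<and>
        (\<forall>Q. is_arg_min (measure_objective f \<alpha> P l) (\<lambda>Q. Q \<in> space (prob_algebra P)) Q \<longleftrightarrow>
           Q = density P (\<lambda>z. ennreal (u_fun f \<alpha> l lam z)))"
    proof (intro allI impI)
      fix lam :: real assume "mass lam = 1"
      then interpret normalized_problem P f \<alpha> l lam
        by unfold_locales
      show "is_arg_min (density_objective f \<alpha> P l) (\<lambda>u. u \<in> feasible_densities P)
          (u_fun f \<alpha> l lam) \<and>
        (\<forall>v. is_arg_min (density_objective f \<alpha> P l) (\<lambda>u. u \<in> feasible_densities P) v \<longrightarrow>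
           (AE z in P. v z = u_fun f \<alpha> l lam z)) \<and>
        (\<forall>Q. is_arg_min (measure_objective f \<alpha> P l) (\<lambda>Q. Q \<in> space (prob_algebra P)) Q \<longleftrightarrow>
           Q = density P (\<lambda>z. ennreal (u_fun f \<alpha> l lam z)))"
        using w_is_arg_min arg_min_AE_unique measure_arg_min_iff by blast
    qed
  qed (use strict_mono_fprime bij_betw_fprime AE_l_finite density_integrand_defined
        measure_objective_density ex1_mass_eq_1 in blast)+
qed

end
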